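(* Let $L$ be a language with $L\in\mathrm{Alt}(f)$ for some $f:\mathbb{N}\to\mathbb{N}$. Then there exists a constant $C$ such that for all $n\in\mathbb{N}$, the query table of $L$ of order $n$ has size at most $2^{C\cdot f(n)}$.
   Context: For a language $L$ and word $u$, the left quotient is $u^{-1}L = \{v \mid uv\in L\}$; if $|u|\le n$ it is called a left quotient of $L$ of order $n$. For a family of languages $\mathcal{L}$ over alphabet $A$ and a word $w\in A^*$, the $\mathcal{L}$-profile of $w$ is the boolean vector indexed by $\mathcal{L}$ whose entry at $M\in\mathcal{L}$ states whether $w\in M$; the size of the query table of $\mathcal{L}$ is the number of distinct $\mathcal{L}$-profiles over all words. The query table of $L$ of order $n$ is the query table of the family of left quotients of $L$ of order $n$. An alternating machine over a finite alphabet $A$ consists of a (possibly infinite) set of states $Q$, an initial state $q_0\in Q$, a transition function $\delta: Q\times A\to\mathcal{B}^+(Q)$ (positive boolean formulae over $Q$) and a set $F\subseteq Q$ of accepting states. For an input word $w$, the acceptance game $\mathcal{G}_{\mathcal{A},w}$ is played by Prover and Verifier: starting in $q_0$, the letters of $w$ are read from left to right; in state $q$ reading letter $a$, the next state is obtained from the formula $\delta(q,a)$, Prover resolving disjunctions and Verifier resolving conjunctions. Prover wins a play if it ends in a state of $F$. The word $w$ is accepted if Prover has a winning strategy; the language recognised is the set of accepted words. For $f:\mathbb{N}\to\mathbb{N}$, a language $L$ is in $\mathrm{Alt}(f)$ if there are an alternating machine recognising $L$ and a constant $C$ such that for all $n\in\mathbb{N}$, the number of states $q$ for which there exists a word $w$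 of length at most $n$ with $q$ appearing in the game $\mathcal{G}_{\mathcal{A},w}$ is at most $C\cdot f(n)$. *)

theory Defs
  imports Main "HOL-Library.FuncSet"
begin

definition left_quotient :: "'a list \<Rightarrow> 'a list set \<Rightarrow> 'a list set" where
  "left_quotient u L = {v. u @ v \<in> L}"

definition left_quotients :: "'a list set \<Rightarrow> nat \<Rightarrow> 'a list set set" where
  "left_quotients L n = {left_quotient u L |u. length u \<le> n}"

text \<open>The restriction makes a profile depend only on its entries at members of the family.\<close>

definition profile :: "'a list set set \<Rightarrow> 'a list \<Rightarrow> ('a list set \<Rightarrow> bool)" where
  "profile \<L> w = restrict (\<lambda>M. w \<in> M) \<L>"

definition query_table :: "'a list set set \<Rightarrow> ('a list set \<Rightarrow> bool) set" where
  "query_table \<L> = range (profile \<L>)"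

definition query_table_of_order :: "'a list set \<Rightarrow> nat \<Rightarrow> ('a list set \<Rightarrow> bool) set" where
  "query_table_of_order L n = query_table (left_quotients L n)"

text \<open>There are no constants for truth and falsity, so resolving all choices in a formula
  always yields a state.\<close>

datatype 'q pos_formula =
    Atom 'q
  | Conj "'q pos_formula" "'q pos_formula"
  | Disj "'q pos_formula" "'q pos_formula"

text \<open>The alphabet is the finite type \<^typ>\<open>'a\<close>; the set of states is the type \<^typ>\<open>'q\<close>,
  which may be infinite.\<close>

record ('a, 'q) alt_machine =
  init :: 'q
  delta :: "'q \<Rightarrow> 'a \<Rightarrow> 'q pos_formula"
  accepting :: "'q set"

text \<open>A position consists of the formula that remains to be resolved and the part of the word
  that remains to be read. Being in state \<open>q\<close> means that the formula is \<open>Atom q\<close>.\<close>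

type_synonym ('a, 'q) position = "'q pos_formula \<times> 'a list"

inductive move :: "('a, 'q) alt_machine \<Rightarrow> ('a, 'q) position \<Rightarrow> ('a, 'q) position \<Rightarrow> bool"
  for M where
  read: "move M (Atom q, a # v) (delta M q a, v)"
| conj_left: "move M (Conj \<phi> \<psi>, v) (\<phi>, v)"
| conj_right: "move M (Conj \<phi> \<psi>, v) (\<psi>, v)"
| disj_left: "move M (Disj \<phi> \<psi>, v) (\<phi>, v)"
| disj_right: "move M (Disj \<phi> \<psi>, v) (\<psi>, v)"

definition prover_position :: "('a, 'q) position \<Rightarrow> bool" where
  "prover_position p \<longleftrightarrow> (\<exists>\<phi> \<psi> v. p = (Disj \<phi> \<psi>, v))"

text \<open>Histories are nonempty lists of positions in chronological order.\<close>

inductive history :: "('a, 'q) alt_machine \<Rightarrow> 'a list \<Rightarrow> ('a, 'q) position list \<Rightarrow> bool"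
  for M w where
  start: "history M w [(Atom (init M), w)]"
| step: "history M w h \<Longrightarrow> move M (last h) p \<Longrightarrow> history M w (h @ [p])"

text \<open>A strategy maps a history ending in a position of Prover to the next position.\<close>

type_synonym ('a, 'q) strategy = "('a, 'q) position list \<Rightarrow> ('a, 'q) position"

definition prover_strategy ::
  "('a, 'q) alt_machine \<Rightarrow> 'a list \<Rightarrow> ('a, 'q) strategy \<Rightarrow> bool" where
  "prover_strategy M w \<sigma> \<longleftrightarrow>
     (\<forall>h. history M w h \<longrightarrow> prover_position (last h) \<longrightarrow> move M (last h) (\<sigma> h))"

inductive consistent ::
  "('a, 'q) alt_machine \<Rightarrow> 'a list \<Rightarrow> ('a, 'q) strategy \<Rightarrow> ('a, 'q) position list \<Rightarrow> bool"
  for M w \<sigma> where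
  start: "consistent M w \<sigma> [(Atom (init M), w)]"
| step: "consistent M w \<sigma> h \<Longrightarrow> move M (last h) p \<Longrightarrow>
    (prover_position (last h) \<longrightarrow> p = \<sigma> h) \<Longrightarrow> consistent M w \<sigma> (h @ [p])"

text \<open>Every move shortens the remaining word or passes to a proper subformula, so there are no
  infinite plays and the plays are exactly the histories without a further move.\<close>

definition is_play :: "('a, 'q) alt_machine \<Rightarrow> 'a list \<Rightarrow> ('a, 'q) position list \<Rightarrow> bool" where
  "is_play M w h \<longleftrightarrow> history M w h \<and> (\<nexists>p. move M (last h) p)"

definition prover_wins :: "('a, 'q) alt_machine \<Rightarrow> ('a, 'q) position list \<Rightarrow> bool" where
  "prover_wins M h \<longleftrightarrow> (\<exists>q \<in> accepting M. last h = (Atom q, []))"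

definition winning_strategy ::
  "('a, 'q) alt_machine \<Rightarrow> 'a list \<Rightarrow> ('a, 'q) strategy \<Rightarrow> bool" where
  "winning_strategy M w \<sigma> \<longleftrightarrow> prover_strategy M w \<sigma> \<and>
     (\<forall>h. is_play M w h \<longrightarrow> consistent M w \<sigma> h \<longrightarrow> prover_wins M h)"

definition language :: "('a, 'q) alt_machine \<Rightarrow> 'a list set" where
  "language M = {w. \<exists>\<sigma>. winning_strategy M w \<sigma>}"

definition appears :: "('a, 'q) alt_machine \<Rightarrow> 'a list \<Rightarrow> 'q \<Rightarrow> bool" where
  "appears M w q \<longleftrightarrow> (\<exists>h v. history M w h \<and> (Atom q, v) \<in> set h)"

definition states_upto :: "('a, 'q) alt_machine \<Rightarrow> nat \<Rightarrow> 'q set" where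
  "states_upto M n = {q. \<exists>w. length w \<le> n \<and> appears M w q}"

text \<open>HOL cannot quantify over the type of states inside a definition, so it is a parameter.
  A theorem that assumes \<open>L \<in> Alt TYPE('q) f\<close> for a type variable \<open>'q\<close> covers
  every set of states.\<close>

definition Alt :: "'q itself \<Rightarrow> (nat \<Rightarrow> nat) \<Rightarrow> 'a::finite list set set" where
  "Alt _ f = {L. \<exists>(M :: ('a, 'q) alt_machine) C :: nat. language M = L \<and>
     (\<forall>n. finite (states_upto M n) \<and> card (states_upto M n) \<le> C * f n)}"

end

theory Submission imports Defs begin

text \<open>Whether Prover wins \<open>u @ v\<close> depends on \<open>v\<close> only through the set of those states reached
  while reading \<open>u\<close> from which Prover wins \<open>v\<close>. If \<open>u\<close> has length at most \<open>n\<close>, these states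
  already appear in the game on \<open>u\<close>, so the profile of \<open>v\<close> is determined by a subset of
  \<open>states_upto M n\<close>.\<close>

primrec eval_formula :: "('q \<Rightarrow> bool) \<Rightarrow> 'q pos_formula \<Rightarrow> bool" where
  "eval_formula V (Atom q) \<longleftrightarrow> V q"
| "eval_formula V (Conj \<phi> \<psi>) \<longleftrightarrow> eval_formula V \<phi> \<and> eval_formula V \<psi>"
| "eval_formula V (Disj \<phi> \<psi>) \<longleftrightarrow> eval_formula V \<phi> \<or> eval_formula V \<psi>"

primrec accepts :: "('a, 'q) alt_machine \<Rightarrow> 'a list \<Rightarrow> 'q \<Rightarrow> bool" where
  "accepts M [] q \<longleftrightarrow> q \<in> accepting M"
| "accepts M (a # v) q \<longleftrightarrow> eval_formula (accepts M v) (delta M q a)"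

text \<open>The backward-induction value of the game. Passing from states to positions covers the
  moments when a transition formula is only partly resolved.\<close>

definition won :: "('a, 'q) alt_machine \<Rightarrow> ('a, 'q) position \<Rightarrow> bool" where
  "won M p \<longleftrightarrow> eval_formula (accepts M (snd p)) (fst p)"

lemma won_simps [simp]:
  "won M (Atom q, []) \<longleftrightarrow> q \<in> accepting M"
  "won M (Atom q, a # v) \<longleftrightarrow> won M (delta M q a, v)"
  "won M (Conj \<phi> \<psi>, v) \<longleftrightarrow> won M (\<phi>, v) \<and> won M (\<psi>, v)"
  "won M (Disj \<phi> \<psi>, v) \<longleftrightarrow> won M (\<phi>, v) \<or> won M (\<psi>, v)"
  by (simp_all add: won_def)

lemma move_simps [simp]:
  "\<not> move M (Atom q, []) p"
  "move M (Atom q, a # v) p \<longleftrightarrow> p = (delta M q a, v)"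
  "move M (Conj \<phi> \<psi>, v) p \<longleftrightarrow> p = (\<phi>, v) \<or> p = (\<psi>, v)"
  "move M (Disj \<phi> \<psi>, v) p \<longleftrightarrow> p = (\<phi>, v) \<or> p = (\<psi>, v)"
  by (auto elim: move.cases intro: move.intros)

lemma prover_position_simps [simp]:
  "\<not> prover_position (Atom q, v)"
  "\<not> prover_position (Conj \<phi> \<psi>, v)"
  "prover_position (Disj \<phi> \<psi>, v)"
  by (simp_all add: prover_position_def)

lemma position_cases [case_names final read conj disj]:
  obtains q where "p = (Atom q, [])"
  | q a v where "p = (Atom q, a # v)"
  | \<phi> \<psi> v where "p = (Conj \<phi> \<psi>, v)"
  | \<phi> \<psi> v where "p = (Disj \<phi> \<psi>, v)"
  by (metis list.exhaust pos_formula.exhaust surj_pair)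

text \<open>Every play is finite: a move shortens the word or passes to a proper subformula. Reading
  a letter can produce an arbitrarily large formula, hence the word is the outer induction, with the
  formula arbitrary.\<close>

lemma move_induct [case_names step]:
  assumes "\<And>p. (\<And>p'. move M p p' \<Longrightarrow> P p') \<Longrightarrow> P p"
  shows "P p"
proof -
  have "P (\<phi>, v)" for \<phi> v
  proof (induction v arbitrary: \<phi>)
    case Nil
    show ?case by (induction \<phi>) (rule assms; auto)+
  next
    case (Cons a v)
    show ?case by (induction \<phi>) (rule assms; auto intro: Cons)+
  qed
  then show ?thesis by (cases p) simp
qed

lemma consistent_history: "consistent M w \<sigma> h \<Longrightarrow> history M w h"
  by (induction rule: consistent.induct) (auto intro: history.intros)

text \<open>Backward induction from the ends of plays. The strategy's own move witnesses a
  disjunction; at a conjunction both moves stay consistent, so both conjuncts are won.\<close>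

lemma consistent_won:
  assumes "winning_strategy M w \<sigma>" and "consistent M w \<sigma> h"
  shows "won M (last h)"
proof -
  have "consistent M w \<sigma> h \<Longrightarrow> last h = p \<Longrightarrow> won M p" for p h
  proof (induction p arbitrary: h rule: move_induct[where M = M])
    case (step p)
    have ext: "won M p'" if "move M p p'" and "prover_position p \<longrightarrow> p' = \<sigma> h" for p'
      using step.IH[OF that(1), of "h @ [p']"] step.prems that
      by (auto intro: consistent.step)
    note hist = consistent_history[OF step.prems(1)]
    show ?case
    proof (cases p rule: position_cases)
      case (final q)
      then have "is_play M w h" using hist step.prems by (simp add: is_play_def)
      then have "prover_wins M h"
        using assms(1) step.prems by (simp add: winning_strategy_def)
      with final step.prems show ?thesis by (simp add: prover_wins_def)
    next
      case (disj \<phi> \<psi> v)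
      then have "move M p (\<sigma> h)"
        using assms(1) hist step.prems
        by (auto simp: winning_strategy_def prover_strategy_def)
      with ext[of "\<sigma> h"] disj show ?thesis by auto
    qed (use ext in auto)
  qed
  with assms(2) show ?thesis by blast
qed

text \<open>The implication keeps the choice satisfiable at a disjunction that is not won, where a
  strategy must still offer a legal move.\<close>

definition greedy :: "('a, 'q) alt_machine \<Rightarrow> ('a, 'q) strategy" where
  "greedy M h = (SOME p. move M (last h) p \<and> (won M (last h) \<longrightarrow> won M p))"

lemma greedy:
  assumes "prover_position (last h)"
  shows "move M (last h) (greedy M h) \<and> (won M (last h) \<longrightarrow> won M (greedy M h))"
  unfolding greedy_def
  by (rule someI_ex) (use assms in \<open>auto simp: prover_position_def; blast\<close>)

text \<open>Being won is an invariant: \<open>greedy\<close> preserves it at disjunctions, and at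
  every other position all successors of a won position are won.\<close>

lemma greedy_won:
  assumes "consistent M w (greedy M) h" and "won M (Atom (init M), w)"
  shows "won M (last h)"
  using assms(1)
proof induction
  case (step h p)
  then show ?case
    using greedy[of h M] by (cases "last h" rule: position_cases) auto
qed (simp add: assms(2))

lemma language_iff_won: "w \<in> language M \<longleftrightarrow> won M (Atom (init M), w)"
proof
  assume "w \<in> language M"
  then obtain \<sigma> where "winning_strategy M w \<sigma>" by (auto simp: language_def)
  from consistent_won[OF this consistent.start] show "won M (Atom (init M), w)" by simp
next
  assume won: "won M (Atom (init M), w)"
  \<comment> \<open>A play can only stop at some \<open>(Atom q, [])\<close>, and such a position is
    won exactly if \<open>q\<close> is accepting.\<close>
  have "prover_wins M h" if "is_play M w h" and "consistent M w (greedy M) h" for h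
    using greedy_won[OF that(2) won] that(1)
    by (cases "last h" rule: position_cases) (auto simp: is_play_def prover_wins_def)
  then have "winning_strategy M w (greedy M)"
    by (simp add: winning_strategy_def prover_strategy_def greedy)
  then show "w \<in> language M" by (auto simp: language_def)
qed

text \<open>Until \<open>u\<close> is used up, the games on \<open>u @ v\<close> and
  \<open>u @ v'\<close> have the same moves as the game on \<open>u\<close>. Following histories of
  the latter guarantees that each state reached at its end appears in it, so that
  \<open>agree\<close> applies there.\<close>

lemma won_append_cong:
  assumes agree: "\<And>q. appears M u q \<Longrightarrow> accepts M v q \<longleftrightarrow> accepts M v' q"
    and "history M u h" and "last h = (\<phi>, x)"
  shows "won M (\<phi>, x @ v) \<longleftrightarrow> won M (\<phi>, x @ v')"
proof -
  have "history M u h \<Longrightarrow> last h = p \<Longrightarrow>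
      won M (fst p, snd p @ v) \<longleftrightarrow> won M (fst p, snd p @ v')" for p h
  proof (induction p arbitrary: h rule: move_induct[where M = M])
    case (step p)
    have ext: "won M (fst p', snd p' @ v) \<longleftrightarrow> won M (fst p', snd p' @ v')"
      if "move M p p'" for p'
      using step.IH[OF that, of "h @ [p']"] step.prems that by (auto intro: history.step)
    show ?case
    proof (cases p rule: position_cases)
      case (final q)
      have "h \<noteq> []" using step.prems(1) by (auto elim: history.cases)
      with final step.prems have "appears M u q"
        unfolding appears_def by (metis last_in_set)
      with final agree show ?thesis by (simp add: won_def)
    qed (use ext in auto)
  qed
  from this[OF assms(2,3)] show ?thesis by simp
qed

lemma profile_left_quotients_cong:
  assumes "\<And>q. q \<in> states_upto M n \<Longrightarrow> accepts M v q \<longleftrightarrow> accepts M v' q"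
  shows "profile (left_quotients (language M) n) v = profile (left_quotients (language M) n) v'"
proof -
  have "u @ v \<in> language M \<longleftrightarrow> u @ v' \<in> language M" if "length u \<le> n" for u
    unfolding language_iff_won
    by (rule won_append_cong[where u = u and h = "[(Atom (init M), u)]"])
      (use assms that in \<open>auto simp: states_upto_def intro: history.start\<close>)
  then show ?thesis
    unfolding profile_def
    by (intro restrict_ext) (auto simp: left_quotients_def left_quotient_def)
qed

lemma query_table_of_order_bound:
  assumes "finite (states_upto M n)"
  shows "finite (query_table_of_order (language M) n)"
    and "card (query_table_of_order (language M) n) \<le> 2 ^ card (states_upto M n)"
proof -
  define P where "P = profile (left_quotients (language M) n)"
  define T where "T v = {q \<in> states_upto M n. accepts M v q}" for v
  \<comment> \<open>\<open>inv T\<close> picks a representative word for each set that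
    \<open>T\<close> attains, so \<open>P\<close> factors through \<open>T\<close>.\<close>
  have "P v = P (inv T (T v))" for v
    unfolding P_def
  proof (rule profile_left_quotients_cong)
    fix q assume "q \<in> states_upto M n"
    moreover have "T (inv T (T v)) = T v" by (simp add: f_inv_into_f)
    ultimately show "accepts M v q \<longleftrightarrow> accepts M (inv T (T v)) q" by (auto simp: T_def)
  qed
  \<comment> \<open>Subsets outside the range of \<open>T\<close> get an arbitrary word from
    \<open>inv T\<close>; this is harmless, since an inclusion suffices for the bound.\<close>
  then have sub: "query_table_of_order (language M) n \<subseteq> (P \<circ> inv T) ` Pow (states_upto M n)"
    unfolding query_table_of_order_def query_table_def P_def[symmetric]
    by (force simp: T_def)
  show "finite (query_table_of_order (language M) n)"
    by (rule finite_subset[OF sub]) (simp add: assms)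
  have "card (query_table_of_order (language M) n) \<le> card (Pow (states_upto M n))"
    using sub assms by (intro surj_card_le) auto
  then show "card (query_table_of_order (language M) n) \<le> 2 ^ card (states_upto M n)"
    by (simp add: card_Pow assms)
qed

theorem theorem3:
  fixes L :: "'a::finite list set" and f :: "nat \<Rightarrow> nat"
  assumes "L \<in> Alt TYPE('q) f"
  shows "\<exists>C :: nat. \<forall>n. finite (query_table_of_order L n) \<and>
           card (query_table_of_order L n) \<le> 2 ^ (C * f n)"
proof -
  from assms obtain M :: "('a, 'q) alt_machine" and C where L: "language M = L"
    and fin: "\<And>n. finite (states_upto M n)"
    and bound: "\<And>n. card (states_upto M n) \<le> C * f n"
    by (auto simp: Alt_def)
  have "card (query_table_of_order L n) \<le> 2 ^ (C * f n)" for n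
  proof -
    have "card (query_table_of_order L n) \<le> 2 ^ card (states_upto M n)"
      using query_table_of_order_bound(2)[OF fin] L by simp
    also have "\<dots> \<le> 2 ^ (C * f n)"
      using bound by (intro power_increasing) auto
    finally show ?thesis .
  qed
  moreover have "finite (query_table_of_order L n)" for n
    using query_table_of_order_bound(1)[OF fin] L by simp
  ultimately show ?thesis by blast
qed

end
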